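(* Let $p\ge 1$ be an integer, $g>0$, and let $\xi$ be a random vector in $\mathbb{R}^p$ such that $$\log \mathbb{E}\exp(\gamma^\top \xi)\le \|\gamma\|^2/2\qquad\text{for all }\gamma\in\mathbb{R}^p\text{ with }\|\gamma\|\le g .$$ Let $w_c,\mu_c,y_c,x_c$ be the quantities determined by $g$ and $p$ as in the context, and let $\kappa=6.6$. Then for each $x$ with $0\le x\le x_c$, $$\mathbb{P}\Bigl(\|\xi\|^2>p+\max\{\sqrt{\kappa x p},\,\kappa x\},\ \|\xi\|\le y_c\Bigr)\le 2e^{-x}.$$ Moreover, with $g_c=g-\sqrt{\mu_c p}=g\,w_c/(1+w_c)$, for every $y\ge y_c$, $$\mathbb{P}(\|\xi\|>y)\le 8.4\exp\Bigl\{-\frac{g_c y}{2}-\frac p2\log\Bigl(1-\frac{g_c}{y}\Bigr)\Bigr\}\le 8.4\exp\Bigl\{-x_c-\frac{g_c(y-y_c)}{2}\Bigr\}.$$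
   Context: $\|\cdot\|$ is the Euclidean norm on $\mathbb{R}^p$. Given $g>0$ and $p$, the number $w_c>0$ is the unique positive solution of $$\frac{w_c(1+w_c)}{(1+w_c^2)^{1/2}}=g\,p^{-1/2},$$ and $$\mu_c=\frac{w_c^2}{1+w_c^2},\qquad y_c=\sqrt{(1+w_c^2)\,p},\qquad x_c=\tfrac12\,p\,\bigl[w_c^2-\log(1+w_c^2)\bigr].$$ *)

theory Defs
  imports "HOL-Probability.Probability"
begin

text \<open>\<open>w_c g p\<close> is a definite description; the lemma \<open>w_c_ex1\<close> below shows that it is proper
  whenever \<open>g > 0\<close> and \<open>p > 0\<close>.\<close>

definition w_c :: "real \<Rightarrow> nat \<Rightarrow> real" where
  "w_c g p = (THE w. w > 0 \<and> w * (1 + w) / (1 + w\<^sup>2) powr (1/2) = g * real p powr (-1/2))"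

definition mu_c :: "real \<Rightarrow> nat \<Rightarrow> real" where
  "mu_c g p = (w_c g p)\<^sup>2 / (1 + (w_c g p)\<^sup>2)"

definition y_c :: "real \<Rightarrow> nat \<Rightarrow> real" where
  "y_c g p = sqrt ((1 + (w_c g p)\<^sup>2) * real p)"

definition x_c :: "real \<Rightarrow> nat \<Rightarrow> real" where
  "x_c g p = 1/2 * real p * ((w_c g p)\<^sup>2 - ln (1 + (w_c g p)\<^sup>2))"

definition g_c :: "real \<Rightarrow> nat \<Rightarrow> real" where
  "g_c g p = g - sqrt (mu_c g p * real p)"

text \<open>The bound \<open>log E exp (\<gamma>\<^sup>T \<xi>) \<le> \<parallel>\<gamma>\<parallel>\<^sup>2 / 2\<close> for \<open>\<parallel>\<gamma>\<parallel> \<le> g\<close>.  Integrability is the finiteness of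
  the exponential moment implicit in it; without it the Bochner integral would be \<open>0\<close> and the
  inequality would hold vacuously.\<close>

definition local_exp_moment :: "'a measure \<Rightarrow> ('a \<Rightarrow> 'b::euclidean_space) \<Rightarrow> real \<Rightarrow> bool" where
  "local_exp_moment M \<xi> g \<longleftrightarrow>
     (\<forall>\<gamma>. norm \<gamma> \<le> g \<longrightarrow>
        integrable M (\<lambda>\<omega>. exp (\<gamma> \<bullet> \<xi> \<omega>)) \<and>
        ln (\<integral>\<omega>. exp (\<gamma> \<bullet> \<xi> \<omega>) \<partial>M) \<le> (norm \<gamma>)\<^sup>2 / 2)"

lemma w_c_ex1:
  fixes g :: real and p :: nat
  assumes "g > 0" "p > 0"
  shows "\<exists>!w. w > 0 \<and> w * (1 + w) / (1 + w\<^sup>2) powr (1/2) = g * real p powr (-1/2)"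
proof -
  define f where "f = (\<lambda>w::real. w * (1 + w) / sqrt (1 + w\<^sup>2))"
  have pos: "1 + w\<^sup>2 > 0" for w :: real
    by (smt (verit) zero_le_power2)
  have f_eq: "w * (1 + w) / (1 + w\<^sup>2) powr (1/2) = f w" for w :: real
    unfolding f_def using pos[of w] by (simp add: powr_half_sqrt)
  define c where "c = g * real p powr (-1/2)"
  have c: "c > 0" using assms by (simp add: c_def)
  have mono: "f a < f b" if "0 < a" "a < b" for a b
  proof -
    have sq: "a / sqrt (1 + a\<^sup>2) \<le> b / sqrt (1 + b\<^sup>2)"
    proof (rule power2_le_imp_le)
      have "a\<^sup>2 \<le> b\<^sup>2" using that by (intro power_mono) auto
      then have "a\<^sup>2 / (1 + a\<^sup>2) \<le> b\<^sup>2 / (1 + b\<^sup>2)"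
        using pos[of a] pos[of b] by (simp add: field_simps)
      then show "(a / sqrt (1 + a\<^sup>2))\<^sup>2 \<le> (b / sqrt (1 + b\<^sup>2))\<^sup>2"
        using pos[of a] pos[of b] by (simp add: power_divide)
      show "0 \<le> b / sqrt (1 + b\<^sup>2)" using that by simp
    qed
    have "a / sqrt (1 + a\<^sup>2) > 0" using that pos[of a] by simp
    then have "a / sqrt (1 + a\<^sup>2) * (1 + a) < b / sqrt (1 + b\<^sup>2) * (1 + b)"
      using sq that by (intro mult_le_less_imp_less) auto
    then show ?thesis by (simp add: f_def)
  qed
  have cont: "continuous_on {0..2 * c + 1} f"
    unfolding f_def using pos by (intro continuous_intros) (smt (verit) real_sqrt_gt_zero)
  have "sqrt (1 + (2*c+1)\<^sup>2) \<le> 1 + (2*c+1)"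
    using c by (intro real_le_lsqrt) (auto simp: power2_eq_square algebra_simps)
  then have "2*c+1 \<le> f (2*c+1)"
    unfolding f_def using c pos[of "2*c+1"] by (simp add: pos_le_divide_eq mult_left_mono)
  then have "\<exists>w\<ge>0. w \<le> 2*c+1 \<and> f w = c"
    using c cont by (intro IVT') (auto simp: f_def)
  then obtain w where w: "0 \<le> w" "f w = c" by blast
  with c have "w > 0" by (cases "w = 0") (auto simp: f_def)
  show ?thesis
    unfolding f_eq c_def[symmetric]
  proof (rule ex1I[of _ w])
    show "w > 0 \<and> f w = c" using \<open>w > 0\<close> w by simp
    fix v assume "v > 0 \<and> f v = c"
    then show "v = w" using mono[of v w] mono[of w v] \<open>w > 0\<close> w by (cases v w rule: linorder_cases) auto
  qed
qed

end

theory Submission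
  imports Defs
begin

text \<open>Integrate \<open>exp (\<gamma>\<^sup>T \<xi> - \<parallel>\<gamma>\<parallel>\<^sup>2 / (2 \<mu>))\<close> over the ball \<open>\<parallel>\<gamma>\<parallel> \<le> g\<close> and exchange this integral
  with the expectation.  Completing the square, the inner integral is, up to a constant, \<open>exp (\<mu> \<parallel>\<xi>\<parallel>\<^sup>2 / 2)\<close> times the mass
  that a Gaussian centred at \<open>\<mu> \<xi>\<close> gives to the ball; if \<open>\<parallel>\<xi>\<parallel> \<le> r\<close> and
  \<open>\<mu> r + \<surd>(\<mu> p) \<le> g\<close>, that mass is at least one half, because the median of a chi-square
  variable is at most its mean.  Hence \<open>\<mu> \<parallel>\<xi>\<parallel>\<^sup>2 / 2\<close>, restricted to \<open>\<parallel>\<xi>\<parallel> \<le> r\<close>, has exponential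
  moment at most \<open>2 (1 - \<mu>) powr (- p/2)\<close>.  For \<open>r = y_c\<close> this is available for every
  \<open>\<mu> \<le> \<mu>_c\<close>, and an exponential Markov inequality with optimal \<open>\<mu>\<close> gives the first bound.  The tail
  bound follows by cutting \<open>\<parallel>\<xi>\<parallel> > y\<close> into shells of width \<open>2 ln 2 / g_c\<close> and taking
  \<open>\<mu> = g_c / r\<close> on the shell with outer radius \<open>r\<close>; this width minimises the resulting geometric
  series, whose constant is \<open>8\<close>.\<close>

section \<open>Gaussian mass of the ball of radius sqrt p\<close>

lemma nn_integral_lborel_affine:
  fixes t :: "'b::euclidean_space"
  assumes [measurable]: "f \<in> borel_measurable borel" and "c \<noteq> 0"
  shows "(\<integral>\<^sup>+x. f x \<partial>lborel) = ennreal (\<bar>c\<bar> ^ DIM('b)) * (\<integral>\<^sup>+x. f (t + c *\<^sub>R x) \<partial>lborel)"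
  by (subst lborel_affine[OF \<open>c \<noteq> 0\<close>, of t])
     (simp add: nn_integral_density nn_integral_distr nn_integral_cmult)

text \<open>Polar coordinates with logarithmic radius. The half-line above \<open>a\<close> pulls
  back to the ball of radius \<open>r * exp (- a)\<close>, whose volume decays like exp (- n a) in
  dimension n, and a measure finite on these half-lines is determined by them.\<close>

lemma distr_lborel_ln_norm:
  fixes r :: real
  assumes "r > 0"
  shows "distr lborel borel (\<lambda>x::'b::euclidean_space. ln (r / norm x)) =
    density lborel (\<lambda>s. ennreal (unit_ball_vol DIM('b) * r ^ DIM('b) * (DIM('b) * exp (- (DIM('b) * s)))))"
proof -
  define D where "D = distr lborel borel (\<lambda>x::'b. ln (r / norm x))"
  define c where "c = unit_ball_vol DIM('b) * r ^ DIM('b)"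
  have n: "DIM('b) > 0" by simp
  have c: "c \<ge> 0" using assms by (simp add: c_def)
  have L: "emeasure D {a<..} = ennreal (c * exp (- (DIM('b) * a)))" for a :: real
  proof -
    have "emeasure D {a<..} = emeasure lborel {x::'b. a < ln (r / norm x)}"
      unfolding D_def by (subst emeasure_distr) (auto simp: vimage_def)
    also have "\<dots> = emeasure lborel (ball (0::'b) (r * exp (- a)))"
    proof (rule emeasure_eq_AE)
      \<comment> \<open>At the origin \<open>ln (r / norm x)\<close> is only a default value coming
        from division by zero, so this null set is dropped.\<close>
      have "AE x::'b in lborel. x \<noteq> 0" by (rule AE_lborel_singleton)
      then show "AE x::'b in lborel. x \<in> {x. a < ln (r / norm x)} \<longleftrightarrow> x \<in> ball 0 (r * exp (- a))"
      proof eventually_elim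
        case (elim x)
        then have x: "norm x > 0" by simp
        have "a < ln (r / norm x) \<longleftrightarrow> exp a < r / norm x"
          using x assms by (metis divide_pos_pos exp_less_cancel_iff exp_ln)
        also have "\<dots> \<longleftrightarrow> norm x < r * exp (- a)"
          using x by (simp add: exp_minus field_simps)
        finally show ?case by simp
      qed
    qed auto
    also have "\<dots> = ennreal (c * exp (- (DIM('b) * a)))"
      using assms by (simp add: c_def emeasure_ball power_mult_distrib exp_of_nat_mult[symmetric] mult.assoc)
    finally show ?thesis .
  qed
  show ?thesis
    unfolding D_def[symmetric] c_def[symmetric]
  proof (rule measure_eqI_lessThan)
    show "emeasure D {a<..} < \<infinity>" for a by (simp add: L)
    show "emeasure D {a<..} = emeasure (density lborel (\<lambda>s. ennreal (c * (DIM('b) * exp (- (DIM('b) * s)))))) {a<..}" for a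
    proof -
      have lim: "((\<lambda>s. - (c * exp (- (real DIM('b) * s)))) \<longlongrightarrow> 0) at_top"
        using n by real_asymp
      have "emeasure (density lborel (\<lambda>s. ennreal (c * (DIM('b) * exp (- (DIM('b) * s)))))) {a<..}
        = (\<integral>\<^sup>+s. ennreal (c * (DIM('b) * exp (- (DIM('b) * s)))) * indicator {a<..} s \<partial>lborel)"
        by (subst emeasure_density) auto
      also have "\<dots> = (\<integral>\<^sup>+s. ennreal (c * (DIM('b) * exp (- (DIM('b) * s)))) * indicator {a..} s \<partial>lborel)"
        using AE_lborel_singleton[of a]
        by (intro nn_integral_cong_AE, eventually_elim) (auto simp: indicator_def)
      also have "\<dots> = ennreal (0 - (- (c * exp (- (DIM('b) * a)))))"
        using c by (intro nn_integral_FTC_atLeast[OF _ _ _ lim])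
          (auto intro!: derivative_eq_intros)
      finally show ?thesis by (simp add: L)
    qed
  qed (simp_all add: D_def)
qed

text \<open>This is sinh (2 s) >= 2 s: the derivative of the difference is twice the square of exp x
  - exp (- x). It compares the radial exponents at s and -s.\<close>

lemma four_mult_le_exp_diff:
  fixes s :: real
  assumes "s \<ge> 0"
  shows "4 * s \<le> exp (2 * s) - exp (- (2 * s))"
proof -
  have "(\<lambda>s::real. exp (2 * s) - exp (- (2 * s)) - 4 * s) 0 \<le> (\<lambda>s. exp (2 * s) - exp (- (2 * s)) - 4 * s) s"
  proof (rule DERIV_nonneg_imp_nondecreasing[OF assms])
    fix x :: real
    have "2 * (exp x - exp (- x))\<^sup>2 = 2 * exp (2 * x) + 2 * exp (- (2 * x)) - 4"
      by (simp add: power2_diff power2_eq_square exp_add[symmetric] algebra_simps)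
    then have "2 * exp (2 * x) + 2 * exp (- (2 * x)) - 4 \<ge> 0"
      by (metis zero_le_power2 zero_le_mult_iff zero_le_numeral)
    then show "\<exists>y. ((\<lambda>s. exp (2 * s) - exp (- (2 * s)) - 4 * s) has_real_derivative y) (at x) \<and> 0 \<le> y"
      by (intro exI[of _ "2 * exp (2 * x) + 2 * exp (- (2 * x)) - 4"])
         (auto intro!: derivative_eq_intros)
  qed
  then show ?thesis by simp
qed

text \<open>Left unnormalised, because only the ratio of the total mass to the mass of a ball
  matters.\<close>

definition gauss :: "'b::euclidean_space \<Rightarrow> ennreal" where
  "gauss z = ennreal (exp (- (norm z)\<^sup>2 / 2))"

lemma gauss_measurable [measurable]: "gauss \<in> borel_measurable borel"
  unfolding gauss_def by measurable

text \<open>The inversion \<open>z \<mapsto> p z / \<parallel>z\<parallel>\<^sup>2\<close> is the reflection \<open>s \<mapsto> -s\<close> in the coordinate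
  \<open>s = ln (\<surd>p / \<parallel>z\<parallel>)\<close>; it maps the exterior of the ball to its interior and increases the radial density.\<close>

lemma gauss_outside_le_inside:
  "(\<integral>\<^sup>+z. gauss z * indicator (- cball 0 (sqrt DIM('b))) (z::'b) \<partial>lborel)
    \<le> (\<integral>\<^sup>+z. gauss z * indicator (cball 0 (sqrt DIM('b))) (z::'b::euclidean_space) \<partial>lborel)"
proof -
  define n where "n = DIM('b)"
  have n: "n > 0" by (simp add: n_def)
  \<comment> \<open>In the coordinate s with norm z = sqrt n * exp (- s), Lebesgue measure has
    density \<open>c * exp (- (n * s))\<close>, \<open>gauss\<close> becomes \<open>h\<close>, and
    the ball is the half-line s \<ge> 0.\<close>
  define c where "c = unit_ball_vol n * sqrt n ^ n * n"
  have c: "c \<ge> 0" by (simp add: c_def)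
  define h where "h s = ennreal (exp (- (n * exp (- (2 * s)) / 2)))" for s
  have [measurable]: "h \<in> borel_measurable borel" unfolding h_def by measurable
  have polar: "(\<integral>\<^sup>+(z::'b). f (ln (sqrt n / norm z)) \<partial>lborel) = (\<integral>\<^sup>+s. ennreal (c * exp (- (n * s))) * f s \<partial>lborel)"
    if [measurable]: "f \<in> borel_measurable borel" for f :: "real \<Rightarrow> ennreal"
  proof -
    have "(\<integral>\<^sup>+(z::'b). f (ln (sqrt n / norm z)) \<partial>lborel) = (\<integral>\<^sup>+s. f s \<partial>distr lborel borel (\<lambda>z::'b. ln (sqrt n / norm z)))"
      by (subst nn_integral_distr) auto
    also have "\<dots> = (\<integral>\<^sup>+s. ennreal (unit_ball_vol n * sqrt n ^ n * (n * exp (- (n * s)))) * f s \<partial>lborel)"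
      using n unfolding n_def by (subst distr_lborel_ln_norm) (auto simp: nn_integral_density)
    finally show ?thesis by (simp add: c_def mult.assoc)
  qed
  have gauss_polar: "gauss z = h (ln (sqrt n / norm z))" if "z \<noteq> 0" for z :: 'b
  proof -
    have "exp (- (2 * ln (sqrt n / norm z))) = exp (ln ((norm z)\<^sup>2 / n))"
      using that n by (simp add: ln_div ln_sqrt ln_realpow)
    also have "\<dots> = (norm z)\<^sup>2 / n" using that n by simp
    finally show ?thesis using n by (simp add: gauss_def h_def)
  qed
  have mem: "ln (sqrt n / norm z) \<ge> 0 \<longleftrightarrow> z \<in> cball 0 (sqrt n)" if "z \<noteq> 0" for z :: 'b
    using that n by (simp add: ln_ge_zero_iff)
  have nz: "AE z::'b in lborel. z \<noteq> 0" by (rule AE_lborel_singleton)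
  have "(\<integral>\<^sup>+z. gauss z * indicator (- cball 0 (sqrt n)) (z::'b) \<partial>lborel)
      = (\<integral>\<^sup>+(z::'b). h (ln (sqrt n / norm z)) * indicator {..<0} (ln (sqrt n / norm z)) \<partial>lborel)"
    using nz by (intro nn_integral_cong_AE, eventually_elim)
      (use mem in \<open>auto simp: gauss_polar indicator_def not_le[symmetric]\<close>)
  also have "\<dots> = (\<integral>\<^sup>+s. ennreal (c * exp (- (n * s))) * (h s * indicator {..<0} s) \<partial>lborel)"
    by (subst polar) auto
  also have "\<dots> = (\<integral>\<^sup>+s. ennreal (c * exp (- (n * (- s)))) * (h (- s) * indicator {..<0} (- s)) \<partial>lborel)"
    by (subst nn_integral_real_affine[where t = 0 and c = "- 1"]) auto
  also have "\<dots> \<le> (\<integral>\<^sup>+s. ennreal (c * exp (- (n * s))) * (h s * indicator {0..} s) \<partial>lborel)"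
  proof (rule nn_integral_mono)
    fix s :: real
    \<comment> \<open>After the reflection the exterior is s > 0. The two sides are the radial
      densities at -s and s, and comparing exponents leaves \<open>four_mult_le_exp_diff\<close>
      times n.\<close>
    have "exp (n * s - n * exp (2 * s) / 2) \<le> exp (- (n * s) - n * exp (- (2 * s)) / 2)" if "s > 0"
    proof -
      have "real n * (4 * s) \<le> n * (exp (2 * s) - exp (- (2 * s)))"
        using four_mult_le_exp_diff[of s] that by (intro mult_left_mono) auto
      then show ?thesis by (simp add: algebra_simps)
    qed
    then show "ennreal (c * exp (- (n * (- s)))) * (h (- s) * indicator {..<0} (- s))
        \<le> ennreal (c * exp (- (n * s))) * (h s * indicator {0..} s)"
      using c by (auto simp: h_def indicator_def ennreal_mult'[symmetric] mult.assoc exp_add[symmetric]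
          intro!: ennreal_leI mult_left_mono)
  qed
  also have "\<dots> = (\<integral>\<^sup>+(z::'b). h (ln (sqrt n / norm z)) * indicator {0..} (ln (sqrt n / norm z)) \<partial>lborel)"
    by (subst polar) auto
  also have "\<dots> = (\<integral>\<^sup>+z. gauss z * indicator (cball 0 (sqrt n)) (z::'b) \<partial>lborel)"
    using nz by (intro nn_integral_cong_AE, eventually_elim)
      (use mem in \<open>auto simp: gauss_polar indicator_def\<close>)
  finally show ?thesis by (simp add: n_def)
qed

lemma cball_measurable [measurable]: "cball (x::'b::euclidean_space) r \<in> sets borel"
  by simp

text \<open>The exterior mass is dominated by the interior mass, so the ball carries at least half
  of the total. This is the source of the factor 2 in the moment bound.\<close>

lemma gauss_total_le:
  "(\<integral>\<^sup>+z. gauss (z::'b::euclidean_space) \<partial>lborel)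
    \<le> 2 * (\<integral>\<^sup>+z. gauss z * indicator (cball 0 (sqrt DIM('b))) (z::'b) \<partial>lborel)"
proof -
  have "(\<integral>\<^sup>+z. gauss (z::'b) \<partial>lborel) =
     (\<integral>\<^sup>+z. gauss z * indicator (- cball 0 (sqrt DIM('b))) z + gauss z * indicator (cball 0 (sqrt DIM('b))) (z::'b) \<partial>lborel)"
    by (intro nn_integral_cong) (auto simp: indicator_def)
  also have "\<dots> = (\<integral>\<^sup>+z. gauss z * indicator (- cball 0 (sqrt DIM('b))) (z::'b) \<partial>lborel)
     + (\<integral>\<^sup>+z. gauss z * indicator (cball 0 (sqrt DIM('b))) (z::'b) \<partial>lborel)"
    by (intro nn_integral_add) auto
  finally show ?thesis
    using gauss_outside_le_inside[where 'b='b] by (auto simp: mult_2 intro: add_right_mono)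
qed

text \<open>Together with \<open>gauss_inside_pos\<close>, this allows the mass of the ball to be
  cancelled in the moment bound.\<close>

lemma gauss_inside_finite:
  "(\<integral>\<^sup>+z. gauss z * indicator (cball 0 r) (z::'b::euclidean_space) \<partial>lborel) < \<infinity>"
proof -
  have "(\<integral>\<^sup>+z. gauss z * indicator (cball 0 r) (z::'b) \<partial>lborel)
      \<le> (\<integral>\<^sup>+z. indicator (cball 0 r) (z::'b) \<partial>lborel)"
    by (intro nn_integral_mono) (auto simp: gauss_def indicator_def)
  also have "\<dots> < \<infinity>" using emeasure_lborel_cball_finite by simp
  finally show ?thesis .
qed

lemma gauss_inside_pos:
  fixes r :: real
  assumes "r > 0"
  shows "(\<integral>\<^sup>+z. gauss z * indicator (cball 0 r) (z::'b::euclidean_space) \<partial>lborel) > 0"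
proof -
  have "0 < ennreal (exp (- r\<^sup>2 / 2)) * emeasure lborel (cball (0::'b) r)"
    using assms by (simp add: ennreal_zero_less_mult_iff emeasure_cball)
  also have "\<dots> = (\<integral>\<^sup>+z. ennreal (exp (- r\<^sup>2 / 2)) * indicator (cball 0 r) (z::'b) \<partial>lborel)"
    by (subst nn_integral_cmult_indicator) auto
  also have "\<dots> \<le> (\<integral>\<^sup>+z. gauss z * indicator (cball 0 r) (z::'b) \<partial>lborel)"
    by (intro nn_integral_mono) (auto simp: gauss_def indicator_def intro!: ennreal_leI power_mono)
  finally show ?thesis .
qed

section \<open>Exponential moments of the truncated squared norm\<close>

lemma gauss_scale:
  fixes a :: real
  assumes "a > 0"
  shows "ennreal (a ^ DIM('b)) * (\<integral>\<^sup>+z. gauss (a *\<^sub>R (z::'b::euclidean_space)) \<partial>lborel) = (\<integral>\<^sup>+z. gauss (z::'b) \<partial>lborel)"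
  using nn_integral_lborel_affine[of gauss a "0::'b"] assms by simp

text \<open>Substitute \<gamma> = \<mu> v + sqrt \<mu> z, which completes the square. The third
  assumption makes this map send the ball of radius sqrt p into the ball of radius \<open>g\<close>,
  so restricting z to the former only loses mass.\<close>

lemma gauss_tilt_ge:
  fixes v :: "'b::euclidean_space" and \<mu> r g :: real
  assumes "\<mu> > 0" "norm v \<le> r" "\<mu> * r + sqrt (\<mu> * DIM('b)) \<le> g"
  shows "ennreal (sqrt \<mu> ^ DIM('b) * exp (\<mu> * (norm v)\<^sup>2 / 2))
      * (\<integral>\<^sup>+z. gauss z * indicator (cball 0 (sqrt DIM('b))) (z::'b) \<partial>lborel)
    \<le> (\<integral>\<^sup>+\<gamma>. ennreal (exp (\<gamma> \<bullet> v - (norm \<gamma>)\<^sup>2 / (2 * \<mu>))) * indicator (cball 0 g) \<gamma> \<partial>lborel)"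
proof -
  let ?f = "\<lambda>\<gamma>. ennreal (exp (\<gamma> \<bullet> v - (norm \<gamma>)\<^sup>2 / (2 * \<mu>))) * indicator (cball 0 g) \<gamma>"
  have "ennreal (sqrt \<mu> ^ DIM('b)) * (ennreal (exp (\<mu> * (norm v)\<^sup>2 / 2))
      * (\<integral>\<^sup>+z. gauss z * indicator (cball 0 (sqrt DIM('b))) (z::'b) \<partial>lborel))
    = ennreal (sqrt \<mu> ^ DIM('b)) * (\<integral>\<^sup>+z. ennreal (exp (\<mu> * (norm v)\<^sup>2 / 2)) *
        (gauss z * indicator (cball 0 (sqrt DIM('b))) (z::'b)) \<partial>lborel)"
    by (subst nn_integral_cmult) auto
  also have "\<dots> \<le> ennreal (sqrt \<mu> ^ DIM('b)) * (\<integral>\<^sup>+z. ?f (\<mu> *\<^sub>R v + sqrt \<mu> *\<^sub>R z) \<partial>lborel)"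
  proof (intro mult_left_mono nn_integral_mono)
    fix z :: 'b
    show "ennreal (exp (\<mu> * (norm v)\<^sup>2 / 2)) * (gauss z * indicator (cball 0 (sqrt DIM('b))) z)
       \<le> ?f (\<mu> *\<^sub>R v + sqrt \<mu> *\<^sub>R z)"
    proof (cases "norm z \<le> sqrt DIM('b)")
      case True
      have "norm (\<mu> *\<^sub>R v + sqrt \<mu> *\<^sub>R z) \<le> \<mu> * norm v + sqrt \<mu> * norm z"
        using norm_triangle_ineq[of "\<mu> *\<^sub>R v" "sqrt \<mu> *\<^sub>R z"] assms by simp
      also have "\<dots> \<le> \<mu> * r + sqrt \<mu> * sqrt DIM('b)"
        using assms True by (intro add_mono mult_left_mono) auto
      finally have "norm (\<mu> *\<^sub>R v + sqrt \<mu> *\<^sub>R z) \<le> g"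
        using assms by (simp add: real_sqrt_mult)
      moreover have "(\<mu> *\<^sub>R v + sqrt \<mu> *\<^sub>R z) \<bullet> v - (norm (\<mu> *\<^sub>R v + sqrt \<mu> *\<^sub>R z))\<^sup>2 / (2 * \<mu>)
          = \<mu> * (norm v)\<^sup>2 / 2 - (norm z)\<^sup>2 / 2"
      proof -
        have "(norm (\<mu> *\<^sub>R v + sqrt \<mu> *\<^sub>R z))\<^sup>2 = \<mu>\<^sup>2 * (norm v)\<^sup>2 + 2 * \<mu> * sqrt \<mu> * (z \<bullet> v) + (sqrt \<mu>)\<^sup>2 * (norm z)\<^sup>2"
          unfolding power2_norm_eq_inner
          by (simp add: inner_simps inner_commute power2_eq_square algebra_simps)
        moreover have "(\<mu> *\<^sub>R v + sqrt \<mu> *\<^sub>R z) \<bullet> v = \<mu> * (norm v)\<^sup>2 + sqrt \<mu> * (z \<bullet> v)"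
          by (simp add: power2_norm_eq_inner inner_simps)
        ultimately show ?thesis using assms by (simp add: field_simps power2_eq_square)
      qed
      ultimately show ?thesis
        using True by (simp add: gauss_def ennreal_mult'[symmetric] exp_add[symmetric])
    qed simp
  qed auto
  also have "\<dots> = (\<integral>\<^sup>+\<gamma>. ?f \<gamma> \<partial>lborel)"
    using assms nn_integral_lborel_affine[of ?f "sqrt \<mu>" "\<mu> *\<^sub>R v"] by simp
  finally show ?thesis using assms by (simp add: ennreal_mult' mult.assoc)
qed

text \<open>Both orders of integration yield a multiple of the Gaussian mass \<open>J\<close> of the
  ball: a lower bound by tilting for fixed \<omega>, an upper bound by the moment assumption for
  fixed \<gamma>. Cancelling \<open>J\<close> leaves the claim.\<close>

lemma (in prob_space) exp_moment_truncated:
  fixes \<xi> :: "'a \<Rightarrow> 'b::euclidean_space" and \<mu> r g :: real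
  assumes [measurable]: "\<xi> \<in> borel_measurable M"
    and le: "local_exp_moment M \<xi> g"
    and \<mu>: "0 < \<mu>" "\<mu> < 1" "\<mu> * r + sqrt (\<mu> * DIM('b)) \<le> g"
  shows "ennreal (sqrt (1 - \<mu>) ^ DIM('b)) *
    (\<integral>\<^sup>+\<omega>. ennreal (exp (\<mu> * (norm (\<xi> \<omega>))\<^sup>2 / 2)) * indicator (cball 0 r) (\<xi> \<omega>) \<partial>M) \<le> 2"
proof -
  define J where "J = (\<integral>\<^sup>+z. gauss z * indicator (cball 0 (sqrt DIM('b))) (z::'b) \<partial>lborel)"
  define E where "E = (\<integral>\<^sup>+\<omega>. ennreal (exp (\<mu> * (norm (\<xi> \<omega>))\<^sup>2 / 2)) * indicator (cball 0 r) (\<xi> \<omega>) \<partial>M)"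
  define w where "w \<gamma> = ennreal (exp (- (norm \<gamma>)\<^sup>2 / (2 * \<mu>))) * indicator (cball 0 g) \<gamma>" for \<gamma> :: 'b
  have [measurable]: "w \<in> borel_measurable borel" unfolding w_def by measurable
  \<comment> \<open>The moment bound adds half the squared norm of \<gamma> to the exponent in
    \<open>w\<close>. What remains is a Gaussian with precision 1 / \<mu> - 1, the square of
    \<open>a\<close>.\<close>
  define a where "a = sqrt (1 - \<mu>) / sqrt \<mu>"
  have a: "a > 0" "a * sqrt \<mu> = sqrt (1 - \<mu>)" "a\<^sup>2 = 1 / \<mu> - 1"
    using \<mu> by (auto simp: a_def power_divide diff_divide_distrib)
  interpret P: pair_sigma_finite M "lborel :: 'b measure" ..
  have moment: "(\<integral>\<^sup>+\<omega>. ennreal (exp (\<gamma> \<bullet> \<xi> \<omega>)) \<partial>M) \<le> ennreal (exp ((norm \<gamma>)\<^sup>2 / 2))"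
    if "norm \<gamma> \<le> g" for \<gamma>
  proof -
    have int: "integrable M (\<lambda>\<omega>. exp (\<gamma> \<bullet> \<xi> \<omega>))"
      and ln: "ln (\<integral>\<omega>. exp (\<gamma> \<bullet> \<xi> \<omega>) \<partial>M) \<le> (norm \<gamma>)\<^sup>2 / 2"
      using le that by (auto simp: local_exp_moment_def)
    have "(\<integral>\<omega>. exp (\<gamma> \<bullet> \<xi> \<omega>) \<partial>M) \<le> exp ((norm \<gamma>)\<^sup>2 / 2)"
    \<comment> \<open>\<open>exp\<close> undoes \<open>ln\<close> only at positive arguments;
      otherwise the bound is immediate.\<close>
    proof (cases "(\<integral>\<omega>. exp (\<gamma> \<bullet> \<xi> \<omega>) \<partial>M) > 0")
      case True
      with ln show ?thesis by (metis exp_le_cancel_iff exp_ln)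
    next
      case False
      then show ?thesis by (smt (verit) exp_gt_zero)
    qed
    then show ?thesis
      using int by (subst nn_integral_eq_integral) (auto intro!: ennreal_leI)
  qed
  have "ennreal (sqrt \<mu> ^ DIM('b)) * J * E =
     (\<integral>\<^sup>+\<omega>. ennreal (sqrt \<mu> ^ DIM('b)) * J *
      (ennreal (exp (\<mu> * (norm (\<xi> \<omega>))\<^sup>2 / 2)) * indicator (cball 0 r) (\<xi> \<omega>)) \<partial>M)"
    unfolding E_def by (subst nn_integral_cmult) auto
  also have "\<dots> \<le> (\<integral>\<^sup>+\<omega>. (\<integral>\<^sup>+\<gamma>. ennreal (exp (\<gamma> \<bullet> \<xi> \<omega>)) * w \<gamma> \<partial>lborel) \<partial>M)"
  proof (rule nn_integral_mono)
    fix \<omega>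
    have "(\<integral>\<^sup>+\<gamma>. ennreal (exp (\<gamma> \<bullet> \<xi> \<omega>)) * w \<gamma> \<partial>lborel)
      = (\<integral>\<^sup>+\<gamma>. ennreal (exp (\<gamma> \<bullet> \<xi> \<omega> - (norm \<gamma>)\<^sup>2 / (2 * \<mu>))) * indicator (cball 0 g) \<gamma> \<partial>lborel)"
      by (intro nn_integral_cong)
         (simp add: w_def mult.assoc[symmetric] ennreal_mult'[symmetric] exp_add[symmetric])
    then show "ennreal (sqrt \<mu> ^ DIM('b)) * J *
        (ennreal (exp (\<mu> * (norm (\<xi> \<omega>))\<^sup>2 / 2)) * indicator (cball 0 r) (\<xi> \<omega>))
      \<le> (\<integral>\<^sup>+\<gamma>. ennreal (exp (\<gamma> \<bullet> \<xi> \<omega>)) * w \<gamma> \<partial>lborel)"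
      using gauss_tilt_ge[of \<mu> "\<xi> \<omega>" r g] \<mu>
      by (cases "norm (\<xi> \<omega>) \<le> r") (auto simp: J_def ennreal_mult' mult_ac)
  qed
  also have "\<dots> = (\<integral>\<^sup>+\<gamma>. (\<integral>\<^sup>+\<omega>. ennreal (exp (\<gamma> \<bullet> \<xi> \<omega>)) * w \<gamma> \<partial>M) \<partial>lborel)"
    by (rule P.Fubini'[symmetric]) measurable
  also have "\<dots> \<le> (\<integral>\<^sup>+\<gamma>. gauss (a *\<^sub>R (\<gamma>::'b)) \<partial>lborel)"
  proof (rule nn_integral_mono)
    fix \<gamma> :: 'b
    have "(\<integral>\<^sup>+\<omega>. ennreal (exp (\<gamma> \<bullet> \<xi> \<omega>)) * w \<gamma> \<partial>M) = (\<integral>\<^sup>+\<omega>. ennreal (exp (\<gamma> \<bullet> \<xi> \<omega>)) \<partial>M) * w \<gamma>"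
      by (rule nn_integral_multc) measurable
    also have "\<dots> \<le> gauss (a *\<^sub>R \<gamma>)"
    proof (cases "norm \<gamma> \<le> g")
      case True
      then have "(\<integral>\<^sup>+\<omega>. ennreal (exp (\<gamma> \<bullet> \<xi> \<omega>)) \<partial>M) * w \<gamma> \<le> ennreal (exp ((norm \<gamma>)\<^sup>2 / 2)) * w \<gamma>"
        by (intro mult_right_mono moment) auto
      also have "\<dots> = gauss (a *\<^sub>R \<gamma>)"
        using True \<mu> by (simp add: w_def gauss_def ennreal_mult'[symmetric] exp_add[symmetric] power_mult_distrib a(3) field_simps)
      finally show ?thesis .
    qed (simp add: w_def)
    finally show "(\<integral>\<^sup>+\<omega>. ennreal (exp (\<gamma> \<bullet> \<xi> \<omega>)) * w \<gamma> \<partial>M) \<le> gauss (a *\<^sub>R \<gamma>)" .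
  qed
  finally have "ennreal (a ^ DIM('b)) * (ennreal (sqrt \<mu> ^ DIM('b)) * J * E)
      \<le> ennreal (a ^ DIM('b)) * (\<integral>\<^sup>+\<gamma>. gauss (a *\<^sub>R (\<gamma>::'b)) \<partial>lborel)"
    by (rule mult_left_mono) simp
  also have "\<dots> \<le> 2 * J"
    unfolding gauss_scale[OF a(1)] J_def by (rule gauss_total_le)
  also have "ennreal (a ^ DIM('b)) * (ennreal (sqrt \<mu> ^ DIM('b)) * J * E) = J * (ennreal (sqrt (1 - \<mu>) ^ DIM('b)) * E)"
    unfolding a(2)[symmetric] power_mult_distrib using a(1) \<mu>
    by (simp add: ennreal_mult mult_ac)
  finally have "J * (ennreal (sqrt (1 - \<mu>) ^ DIM('b)) * E) \<le> J * 2"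
    by (simp add: mult.commute)
  moreover have "J \<noteq> 0" "J \<noteq> top"
    using gauss_inside_pos[of "sqrt DIM('b)", where 'b='b] gauss_inside_finite[of "sqrt DIM('b)", where 'b='b]
    by (auto simp: J_def)
  ultimately show ?thesis
    unfolding E_def[symmetric] by (simp add: ennreal_mult_le_mult_iff)
qed

section \<open>Tail bounds with a free parameter\<close>

text \<open>Markov's inequality for the truncated moment. The prefactor is moved into the exponent,
  where \<mu> can be optimised.\<close>

lemma (in prob_space) truncated_norm_tail:
  fixes \<xi> :: "'a \<Rightarrow> 'b::euclidean_space" and \<mu> r g :: real
  assumes [measurable]: "\<xi> \<in> borel_measurable M"
    and "local_exp_moment M \<xi> g"
    and \<mu>: "0 < \<mu>" "\<mu> < 1" "\<mu> * r + sqrt (\<mu> * DIM('b)) \<le> g"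
  shows "prob {\<omega> \<in> space M. (norm (\<xi> \<omega>))\<^sup>2 > A \<and> norm (\<xi> \<omega>) \<le> r}
    \<le> 2 * exp (- (\<mu> * A / 2) - DIM('b) / 2 * ln (1 - \<mu>))"
proof -
  define S where "S = {\<omega> \<in> space M. (norm (\<xi> \<omega>))\<^sup>2 > A \<and> norm (\<xi> \<omega>) \<le> r}"
  have [measurable]: "S \<in> events" unfolding S_def by measurable
  define q where "q = sqrt (1 - \<mu>) ^ DIM('b)"
  have q: "q = exp (DIM('b) / 2 * ln (1 - \<mu>))"
  proof -
    have "sqrt (1 - \<mu>) = exp (ln (1 - \<mu>) / 2)"
      using \<mu> by (simp add: ln_sqrt[symmetric])
    then show ?thesis by (simp add: q_def exp_of_nat_mult[symmetric])
  qed
  have "ennreal (q * (exp (\<mu> * A / 2) * prob S)) = ennreal q * (ennreal (exp (\<mu> * A / 2)) * emeasure M S)"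
    by (simp add: q emeasure_eq_measure ennreal_mult')
  also have "\<dots> = ennreal q * (\<integral>\<^sup>+\<omega>. ennreal (exp (\<mu> * A / 2)) * indicator S \<omega> \<partial>M)"
    by (subst nn_integral_cmult_indicator) auto
  also have "\<dots> \<le> ennreal q * (\<integral>\<^sup>+\<omega>. ennreal (exp (\<mu> * (norm (\<xi> \<omega>))\<^sup>2 / 2)) * indicator (cball 0 r) (\<xi> \<omega>) \<partial>M)"
    using \<mu> by (intro mult_left_mono nn_integral_mono) (auto simp: S_def indicator_def intro!: ennreal_leI)
  also have "\<dots> \<le> 2"
    unfolding q_def by (rule exp_moment_truncated) fact+
  finally have "q * (exp (\<mu> * A / 2) * prob S) \<le> 2"
    by (simp add: ennreal_le_iff[of 2, simplified])
  then have "prob S \<le> 2 / (q * exp (\<mu> * A / 2))"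
    by (subst pos_le_divide_eq) (auto simp: q mult_ac)
  also have "\<dots> = 2 * exp (- (\<mu> * A / 2) - DIM('b) / 2 * ln (1 - \<mu>))"
    by (simp only: q exp_diff exp_minus) (simp add: field_simps)
  finally show ?thesis by (simp only: S_def)
qed

text \<open>On each shell \<mu> times the outer radius equals \<open>G\<close>, and \<mu> is at most
  \<open>G / y\<close>, so the single assumption on \<open>G\<close> covers all shells at
  once.\<close>

lemma (in prob_space) norm_tail:
  fixes \<xi> :: "'a \<Rightarrow> 'b::euclidean_space" and G y g :: real
  assumes [measurable]: "\<xi> \<in> borel_measurable M"
    and mom: "local_exp_moment M \<xi> g"
    and G: "0 < G" "G < y" "G + sqrt (G / y * DIM('b)) \<le> g"
  shows "prob {\<omega> \<in> space M. norm (\<xi> \<omega>) > y}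
    \<le> 8 * exp (- (G * y / 2) - DIM('b) / 2 * ln (1 - G / y))"
proof -
  define n where "n = real DIM('b)"
  define B where "B = exp (- (G * y / 2) - n / 2 * ln (1 - G / y))"
  \<comment> \<open>Since \<open>G * d / 2 = ln 2\<close>, the bound halves from one shell to the
    next.\<close>
  define d where "d = 2 * ln 2 / G"
  define z where "z k = y + real k * d" for k :: nat
  define S where "S k = {\<omega> \<in> space M. z k < norm (\<xi> \<omega>) \<and> norm (\<xi> \<omega>) \<le> z (Suc k)}" for k
  have [measurable]: "S k \<in> events" for k unfolding S_def by measurable
  have d: "d > 0" using G by (simp add: d_def)
  have zy: "z k \<ge> y" for k using d by (simp add: z_def)
  have shell: "prob (S k) \<le> 4 * B * (1 / 2) ^ k" for k
  proof -
    define \<mu> where "\<mu> = G / z (Suc k)"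
    have pos: "z k > 0" "z (Suc k) > 0" using zy[of k] zy[of "Suc k"] G by auto
    have \<mu>: "0 < \<mu>" "\<mu> \<le> G / y" "G / y < 1" "\<mu> * z (Suc k) = G"
      using zy[of "Suc k"] G pos by (auto simp: \<mu>_def intro!: divide_left_mono)
    have "sqrt (\<mu> * n) \<le> sqrt (G / y * n)"
      using \<mu> by (intro real_sqrt_le_mono mult_right_mono) (auto simp: n_def)
    then have *: "\<mu> * z (Suc k) + sqrt (\<mu> * DIM('b)) \<le> g"
      using \<mu>(4) G(3) unfolding n_def by linarith
    have "S k \<subseteq> {\<omega> \<in> space M. (norm (\<xi> \<omega>))\<^sup>2 > (z k)\<^sup>2 \<and> norm (\<xi> \<omega>) \<le> z (Suc k)}"
      using pos by (auto simp: S_def intro!: power_strict_mono)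
    then have "prob (S k) \<le> prob {\<omega> \<in> space M. (norm (\<xi> \<omega>))\<^sup>2 > (z k)\<^sup>2 \<and> norm (\<xi> \<omega>) \<le> z (Suc k)}"
      by (intro finite_measure_mono) measurable
    also have "\<dots> \<le> 2 * exp (- (\<mu> * (z k)\<^sup>2 / 2) - n / 2 * ln (1 - \<mu>))"
      unfolding n_def using \<mu> * mom by (intro truncated_norm_tail) auto
    also have "\<dots> \<le> 2 * exp (- (G * (z k - d) / 2) - n / 2 * ln (1 - G / y))"
    proof -
      \<comment> \<open>The left side is a difference of squares, because
        \<open>z (Suc k) = z k + d\<close>. Markov at the inner radius with \<mu> tuned to the outer
        one thus costs at most a shift by \<open>d\<close>, that is, a factor 2.\<close>
      have "(z k - d) * z (Suc k) \<le> (z k)\<^sup>2"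
        by (simp add: z_def power2_eq_square algebra_simps)
      then have "z k - d \<le> (z k)\<^sup>2 / z (Suc k)"
        using pos by (simp add: pos_le_divide_eq)
      then have "G * (z k - d) \<le> \<mu> * (z k)\<^sup>2"
        using G by (simp add: \<mu>_def mult_left_mono[of _ _ G] flip: times_divide_eq_right)
      moreover have "n / 2 * ln (1 - G / y) \<le> n / 2 * ln (1 - \<mu>)"
        using \<mu> by (intro mult_left_mono) (auto simp: n_def)
      ultimately show ?thesis by simp
    qed
    also have "- (G * (z k - d) / 2) - n / 2 * ln (1 - G / y)
        = (- (G * y / 2) - n / 2 * ln (1 - G / y)) + ln 2 - real k * ln 2"
      using G by (simp add: z_def d_def field_simps)
    also have "2 * exp \<dots> = 4 * B * (1 / 2) ^ k"
      by (simp only: exp_add exp_diff B_def exp_of_nat_mult) (simp add: power_divide)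
    finally show ?thesis .
  qed
  have sums: "(\<lambda>k. 4 * B * (1 / 2) ^ k) sums (4 * B * 2)"
    using sums_mult[OF geometric_sums[of "1/2 :: real"], of "4 * B"] by simp
  have summable: "summable (\<lambda>k. prob (S k))"
    by (rule summable_comparison_test[OF _ sums_summable[OF sums]]) (auto intro!: exI[of _ 0] shell)
  have "{\<omega> \<in> space M. norm (\<xi> \<omega>) > y} \<subseteq> (\<Union>k. S k)"
  proof safe
    fix \<omega> assume \<omega>: "\<omega> \<in> space M" "y < norm (\<xi> \<omega>)"
    \<comment> \<open>Shells exclude the inner radius and include the outer one, hence ceiling minus
      one rather than floor.\<close>
    define k where "k = nat (\<lceil>(norm (\<xi> \<omega>) - y) / d\<rceil> - 1)"
    have "(norm (\<xi> \<omega>) - y) / d > 0" using \<omega> d by simp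
    then have "real k < (norm (\<xi> \<omega>) - y) / d" "(norm (\<xi> \<omega>) - y) / d \<le> real (Suc k)"
      unfolding k_def by linarith+
    then have "\<omega> \<in> S k" using \<omega> d by (simp add: S_def z_def field_simps)
    then show "\<omega> \<in> (\<Union>k. S k)" by blast
  qed
  then have "prob {\<omega> \<in> space M. norm (\<xi> \<omega>) > y} \<le> prob (\<Union>k. S k)"
    by (intro finite_measure_mono) auto
  also have "\<dots> \<le> (\<Sum>k. prob (S k))"
    by (intro finite_measure_subadditive_countably summable) auto
  also have "\<dots> \<le> 4 * B * 2"
    using suminf_le[OF shell summable sums_summable[OF sums]] sums_unique[OF sums] by simp
  finally show ?thesis by (simp add: B_def n_def)
qed

section \<open>Numerical inequalities behind the constant 6.6\<close>

lemma square_le_diff_ln: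
  fixes u :: real
  assumes "0 \<le> u" "u \<le> 1"
  shows "u\<^sup>2 / 3.3 \<le> u - ln (1 + u)"
proof -
  define h where "h u = u - ln (1 + u) - u\<^sup>2 / 3.3" for u :: real
  have deriv: "(h has_real_derivative u * (1.3 - 2 * u) / (3.3 * (1 + u))) (at u)" if "u \<ge> 0" for u
    unfolding h_def using that
    by (auto intro!: derivative_eq_intros simp: divide_simps) (simp add: algebra_simps)
  have "0 \<le> h u"
  \<comment> \<open>The derivative changes sign once on the unit interval, at 0.65, so the minimum
    of \<open>h\<close> is at an endpoint. At 1 it reduces to ln 2 \<le> 1 - 1/3.3, which follows
    from 25/36.\<close>
  proof (cases "u \<le> 0.65")
    case True
    have "h 0 \<le> h u"
    proof (rule DERIV_nonneg_imp_nondecreasing[OF assms(1)])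
      fix x assume "0 \<le> x" "x \<le> u"
      then show "\<exists>y. (h has_real_derivative y) (at x) \<and> 0 \<le> y"
        using True by (intro exI[of _ "x * (1.3 - 2 * x) / (3.3 * (1 + x))"] conjI deriv) auto
    qed
    then show ?thesis by (simp add: h_def)
  next
    case False
    have "h u \<ge> h 1"
    proof (rule DERIV_nonpos_imp_nonincreasing[OF assms(2)])
      fix x assume "u \<le> x" "x \<le> 1"
      moreover from this False have "x * (1.3 - 2 * x) \<le> 0" by (intro mult_nonneg_nonpos) auto
      ultimately show "\<exists>y. (h has_real_derivative y) (at x) \<and> y \<le> 0"
        using False by (intro exI[of _ "x * (1.3 - 2 * x) / (3.3 * (1 + x))"] conjI deriv)
          (auto intro: divide_nonpos_pos)
    qed
    moreover have "h 1 \<ge> 0" using ln2_le_25_over_36 by (simp add: h_def)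
    ultimately show ?thesis by simp
  qed
  then show ?thesis by (simp add: h_def)
qed

lemma linear_le_diff_ln:
  fixes u :: real
  assumes "1 \<le> u"
  shows "u / 3.3 \<le> u - ln (1 + u)"
proof -
  define h where "h u = u - ln (1 + u) - u / 3.3" for u :: real
  have "h 1 \<le> h u"
  proof (rule DERIV_nonneg_imp_nondecreasing[OF assms])
    fix x :: real assume "1 \<le> x" "x \<le> u"
    then show "\<exists>y. (h has_real_derivative y) (at x) \<and> 0 \<le> y"
      unfolding h_def
      by (intro exI[of _ "1 - 1 / (1 + x) - 1 / 3.3"]) (auto intro!: derivative_eq_intros simp: field_simps)
  qed
  moreover have "h 1 \<ge> 0" using ln2_le_25_over_36 by (simp add: h_def)
  ultimately show ?thesis by (simp add: h_def)
qed

text \<open>At 3.3 s = 1 the maximum switches between its two branches and u passes 1, so each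
  branch falls under exactly one of the two preceding inequalities.\<close>

lemma le_diff_ln_max:
  fixes s :: real
  assumes "s \<ge> 0" and u: "u = max (sqrt (3.3 * s)) (3.3 * s)"
  shows "s \<le> u - ln (1 + u)"
proof (cases "3.3 * s \<le> 1")
  case True
  have "(3.3 * s) * (3.3 * s) \<le> (3.3 * s) * 1"
    using True assms by (intro mult_left_mono) auto
  then have "3.3 * s \<le> sqrt (3.3 * s)"
    by (intro real_le_rsqrt) (simp add: power2_eq_square)
  then have "u = sqrt (3.3 * s)" using u by linarith
  then have "0 \<le> u" "u \<le> 1" "u\<^sup>2 / 3.3 = s" using True assms by auto
  then show ?thesis using square_le_diff_ln[of u] by simp
next
  case False
  have "1 * (3.3 * s) \<le> (3.3 * s) * (3.3 * s)"
    using False by (intro mult_right_mono) auto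
  then have "sqrt (3.3 * s) \<le> 3.3 * s"
    using False by (intro real_le_lsqrt) (auto simp: power2_eq_square)
  then have "u = 3.3 * s" using u by linarith
  then show ?thesis using linear_le_diff_ln[of u] False by simp
qed

section \<open>Choice of parameters and conclusion\<close>

theorem theorem3p1:
  fixes M :: "'a measure" and \<xi> :: "'a \<Rightarrow> real ^ 'n" and g \<kappa> :: real and p :: nat
  assumes "prob_space M"
    and "\<xi> \<in> borel_measurable M"
    and "p = CARD('n)"
    and "g > 0"
    and "local_exp_moment M \<xi> g"
    and "\<kappa> = 6.6"
  shows "(\<forall>x. 0 \<le> x \<and> x \<le> x_c g p \<longrightarrow>
            measure M {\<omega> \<in> space M. (norm (\<xi> \<omega>))\<^sup>2 > real p + max (sqrt (\<kappa> * x * real p)) (\<kappa> * x)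
                                    \<and> norm (\<xi> \<omega>) \<le> y_c g p}
              \<le> 2 * exp (- x))
    \<and> g_c g p = g * w_c g p / (1 + w_c g p)
    \<and> (\<forall>y \<ge> y_c g p.
            measure M {\<omega> \<in> space M. norm (\<xi> \<omega>) > y}
              \<le> 8.4 * exp (- (g_c g p * y / 2) - real p / 2 * ln (1 - g_c g p / y))
          \<and> 8.4 * exp (- (g_c g p * y / 2) - real p / 2 * ln (1 - g_c g p / y))
              \<le> 8.4 * exp (- x_c g p - g_c g p * (y - y_c g p) / 2))"
proof -
  interpret prob_space M by fact
  have p: "p > 0" "DIM(real ^ 'n) = p" using assms by auto
  define w where "w = w_c g p"
  define \<mu>c where "\<mu>c = mu_c g p"
  define Y where "Y = y_c g p"
  define G where "G = g_c g p"
  have "w > 0 \<and> w * (1 + w) / (1 + w\<^sup>2) powr (1/2) = g * real p powr (-1/2)"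
    unfolding w_def w_c_def by (rule theI'[OF w_c_ex1[OF \<open>g > 0\<close> \<open>p > 0\<close>]])
  then have w: "w > 0" and "w * (1 + w) / sqrt (1 + w\<^sup>2) = g / sqrt p"
    using p by (auto simp: powr_half_sqrt powr_minus_divide add_pos_nonneg)
  define W where "W = sqrt (1 + w\<^sup>2)"
  have W: "W > 0" "W\<^sup>2 = 1 + w\<^sup>2" by (auto simp: W_def add_pos_nonneg)
  have nz: "1 + w\<^sup>2 > 0" by (simp add: add_pos_nonneg)
  have g: "g = sqrt p * (w * (1 + w) / W)"
    using \<open>w * (1 + w) / sqrt (1 + w\<^sup>2) = g / sqrt p\<close> p by (simp add: W_def[symmetric])
  have Y: "Y = W * sqrt p" "Y > 0" "Y\<^sup>2 = p * (1 + w\<^sup>2)"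
    using p W by (auto simp: Y_def y_c_def w_def W_def real_sqrt_mult power_mult_distrib add_pos_nonneg)
  have \<mu>c: "\<mu>c = w\<^sup>2 / W\<^sup>2" "0 < \<mu>c" "\<mu>c < 1" "1 - \<mu>c = 1 / (1 + w\<^sup>2)"
    using w nz unfolding \<mu>c_def mu_c_def w_def[symmetric] W(2) by (auto simp: field_simps)
  have sqrt_\<mu>c: "sqrt (\<mu>c * p) = w / W * sqrt p"
    using w W(1) unfolding \<mu>c(1) by (simp add: real_sqrt_mult real_sqrt_divide)
  \<comment> \<open>The first two equations give \<open>\<mu>c * Y + sqrt (\<mu>c * p) = g\<close>:
    at radius \<open>Y\<close> the constraint of the moment bound is saturated by
    \<open>\<mu>c\<close>.\<close>
  have G: "G = \<mu>c * Y" "G + sqrt (\<mu>c * p) = g" "G = g * w / (1 + w)"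
  proof -
    have "G = g - w / W * sqrt p"
      using sqrt_\<mu>c by (simp add: G_def g_c_def \<mu>c_def)
    moreover have "w * (1 + w) / W - w / W = w\<^sup>2 / W"
      by (simp add: diff_divide_distrib[symmetric] power2_eq_square algebra_simps)
    ultimately have *: "G = w\<^sup>2 / W * sqrt p"
      unfolding g by (metis mult.commute right_diff_distrib)
    show "G = \<mu>c * Y" using W(1) unfolding * \<mu>c(1) Y(1) by (simp add: power2_eq_square)
    show "G + sqrt (\<mu>c * p) = g" by (simp add: G_def g_c_def \<mu>c_def)
    have "g / (1 + w) = sqrt p * (w / W)" unfolding g using w by simp
    then have "g * w / (1 + w) = sqrt p * (w / W) * w" by (simp flip: times_divide_eq_left)
    then show "G = g * w / (1 + w)" unfolding * by (simp add: power2_eq_square)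
  qed
  have part1: "prob {\<omega> \<in> space M. (norm (\<xi> \<omega>))\<^sup>2 > p + max (sqrt (\<kappa> * x * p)) (\<kappa> * x) \<and> norm (\<xi> \<omega>) \<le> Y}
      \<le> 2 * exp (- x)" (is "prob ?S \<le> _") if "0 \<le> x" for x
  proof -
    \<comment> \<open>Rescaling by the dimension, with 3.3 = \<kappa> / 2, turns the threshold into
      p (1 + u).\<close>
    define s where "s = 2 * x / p"
    define u where "u = max (sqrt (3.3 * s)) (3.3 * s)"
    have s: "s \<ge> 0" "x = p * s / 2" using that p by (auto simp: s_def)
    have lin: "\<kappa> * x = p * (3.3 * s)" by (simp add: s(2) \<open>\<kappa> = 6.6\<close>)
    have "\<kappa> * x * p = 3.3 * s * (real p)\<^sup>2" by (simp only: lin power2_eq_square mult_ac)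
    then have root: "sqrt (\<kappa> * x * p) = p * sqrt (3.3 * s)"
      by (simp only: real_sqrt_mult real_sqrt_abs) simp
    have max: "max (sqrt (\<kappa> * x * p)) (\<kappa> * x) = p * u"
      by (subst root, subst lin) (simp add: u_def max_mult_distrib_left)
    \<comment> \<open>At x = 0 the bound is 2. If u is at least the square of \<open>w\<close>, the
      threshold reaches the square of \<open>Y\<close> and the event is empty. Otherwise the optimal
      \<mu> stays below \<open>\<mu>c\<close>.\<close>
    consider "x = 0" | "x > 0" "u \<ge> w\<^sup>2" | "x > 0" "u < w\<^sup>2" using \<open>0 \<le> x\<close> by linarith
    then show ?thesis
    proof cases
      case 1
      then show ?thesis by (simp add: order_trans[OF prob_le_1])
    next
      case 2
      have "p + p * u \<ge> (norm (\<xi> \<omega>))\<^sup>2" if "norm (\<xi> \<omega>) \<le> Y" for \<omega>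
      proof -
        have "(norm (\<xi> \<omega>))\<^sup>2 \<le> Y\<^sup>2" using that by (intro power_mono) auto
        also have "\<dots> \<le> p * (1 + u)" unfolding Y(3) using 2 by (intro mult_left_mono) auto
        finally show ?thesis by (simp add: algebra_simps)
      qed
      then have "?S = {}" unfolding max using leD by blast
      then have "prob ?S = 0" by (metis measure_empty)
      then show ?thesis by (metis exp_ge_zero mult_nonneg_nonneg zero_le_numeral)
    next
      case 3
      \<comment> \<open>This minimises the exponent - \<mu> p (1 + u) / 2 - (p / 2) ln (1 - \<mu>);
        the stationarity condition is 1 - \<mu> = 1 / (1 + u).\<close>
      define \<mu> where "\<mu> = u / (1 + u)"
      have u: "u > 0" using 3 p by (simp add: u_def s_def less_max_iff_disj)
      have \<mu>: "0 < \<mu>" "\<mu> < 1" "1 - \<mu> = 1 / (1 + u)"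
        using u by (auto simp: \<mu>_def field_simps)
      have "\<mu> \<le> \<mu>c" using 3 u W by (simp add: \<mu>_def \<mu>c field_simps add_pos_nonneg)
      then have "\<mu> * Y + sqrt (\<mu> * p) \<le> \<mu>c * Y + sqrt (\<mu>c * p)"
        using Y by (intro add_mono real_sqrt_le_mono mult_right_mono) auto
      also have "\<dots> = g" using G by simp
      finally have "prob ?S \<le> 2 * exp (- (\<mu> * (p + p * u) / 2) - p / 2 * ln (1 - \<mu>))"
        unfolding max using truncated_norm_tail[OF assms(2,5) \<mu>(1,2), of Y "p + p * u"] unfolding p by simp
      also have "- (\<mu> * (p + p * u) / 2) - p / 2 * ln (1 - \<mu>) = - (p / 2 * (u - ln (1 + u)))"
      proof -
        have "\<mu> * (p + p * u) = p * u" using u by (simp add: \<mu>_def field_simps)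
        moreover have "ln (1 - \<mu>) = - ln (1 + u)" using u unfolding \<mu>(3) by (simp add: ln_div)
        ultimately show ?thesis by (simp add: field_simps)
      qed
      also have "p / 2 * s \<le> p / 2 * (u - ln (1 + u))"
        using le_diff_ln_max[OF s(1) u_def] by (intro mult_left_mono) auto
      then have "2 * exp (- (p / 2 * (u - ln (1 + u)))) \<le> 2 * exp (- x)"
        by (simp add: s(2))
      finally show ?thesis .
    qed
  qed
  have part2: "prob {\<omega> \<in> space M. norm (\<xi> \<omega>) > y} \<le> 8.4 * exp (- (G * y / 2) - p / 2 * ln (1 - G / y))"
    and part3: "8.4 * exp (- (G * y / 2) - p / 2 * ln (1 - G / y)) \<le> 8.4 * exp (- x_c g p - G * (y - Y) / 2)"
    if "y \<ge> Y" for y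
  proof -
    have y: "y > 0" using that Y by simp
    have G0: "G > 0" using \<mu>c(2) Y(2) by (simp add: G(1))
    have "\<mu>c * Y \<le> \<mu>c * y" using that \<mu>c(2) by (intro mult_left_mono) auto
    then have Gy: "G / y \<le> \<mu>c" using y by (simp add: G(1) pos_divide_le_eq)
    then have "G / y < 1" using \<mu>c(3) by linarith
    then have "G < y" using y by simp
    have "sqrt (G / y * p) \<le> sqrt (\<mu>c * p)"
      using Gy by (intro real_sqrt_le_mono mult_right_mono) auto
    then have "G + sqrt (G / y * DIM(real ^ 'n)) \<le> g" using G(2) unfolding p by linarith
    then have "prob {\<omega> \<in> space M. norm (\<xi> \<omega>) > y} \<le> 8 * exp (- (G * y / 2) - p / 2 * ln (1 - G / y))"
      using norm_tail[OF assms(2,5) G0 \<open>G < y\<close>] unfolding p by blast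
    also have "\<dots> \<le> 8.4 * exp (- (G * y / 2) - p / 2 * ln (1 - G / y))"
      by (intro mult_right_mono) auto
    finally show "prob {\<omega> \<in> space M. norm (\<xi> \<omega>) > y} \<le> 8.4 * exp (- (G * y / 2) - p / 2 * ln (1 - G / y))" .
    \<comment> \<open>The logarithmic term is replaced by its value at y = \<open>Y\<close>, where
      \<open>G / y = \<mu>c\<close>. With \<open>G * Y\<close> equal to p times the square of
      \<open>w\<close>, the exponent at \<open>Y\<close> is exactly \<open>- x_c g p\<close>, and
      the linear term gives the rest.\<close>
    have "ln (1 - \<mu>c) \<le> ln (1 - G / y)" using Gy \<mu>c(3) by simp
    then have "p / 2 * ln (1 - \<mu>c) \<le> p / 2 * ln (1 - G / y)" by (intro mult_left_mono) auto
    moreover have "ln (1 - \<mu>c) = - ln (1 + w\<^sup>2)"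
      unfolding \<mu>c(4) using nz by (simp add: ln_div)
    moreover have "G * Y = p * w\<^sup>2"
    proof -
      have "G * Y = \<mu>c * Y\<^sup>2" by (simp add: G(1) power2_eq_square)
      also have "\<dots> = p * w\<^sup>2" unfolding \<mu>c(1) Y(3) W(2) using nz by simp
      finally show ?thesis .
    qed
    ultimately have "- (G * y / 2) - p / 2 * ln (1 - G / y) \<le> - x_c g p - G * (y - Y) / 2"
      by (simp add: x_c_def w_def[symmetric] field_simps)
    then show "8.4 * exp (- (G * y / 2) - p / 2 * ln (1 - G / y)) \<le> 8.4 * exp (- x_c g p - G * (y - Y) / 2)"
      by simp
  qed
  show ?thesis
    unfolding G_def[symmetric] Y_def[symmetric] w_def[symmetric]
    by (intro conjI allI impI; (elim conjE)?; (rule part1 part2 part3, assumption | rule G(3)))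
qed

end
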